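(* Let $\Gamma_A$ be an $n$-coloured simplicial complex of dimension $k$ with $H_k(\Gamma_A;\mathbb Z_2)\neq 0$, and let $\Gamma_B$ be the simplicial join $B_1*\cdots*B_n$, where every $B_i$ is a discrete set with at least $2$ elements (the vertices in $B_i$ having colour $i$). Then $H_{k+1}(X_{\Gamma_A,\Gamma_B};\mathbb Z_2)\neq 0$.
   Context: All simplicial complexes are finite, and the empty set counts as a simplex of every complex. An $n$-coloured simplicial complex is a simplicial complex whose vertex set is partitioned into $n$ labelled (possibly empty) classes, the colours $1,\dots,n$, so that adjacent vertices have different colours. Let $\Gamma_A,\Gamma_B$ be $n$-coloured with colour classes $A_1,\dots,A_n$ and $B_1,\dots,B_n$. Let $K=\prod_{i=1}^n (A_i*B_i)$, a product of complete bipartite graphs, viewed as a cube complex. A vertex $(x_1,\dots,x_n)$ of $K$, $x_i\in A_i\sqcup B_i$, is identified with the pair $(\mathfrak a,\mathfrak b)$, $\mathfrak a=\{x_i: x_i\in A_i\}$, $\mathfrak b=\{x_i: x_i\in B_i\}$. The coupled link cube complex $X_{\Gamma_A,\Gamma_B}$ is the full subcomplex of $K$ (all cubes all of whose vertices belong to it) on the vertices $(\mathfrak a,\mathfrak b)$ such that $\mathfrak a$ is a (possibly empty) simplex of $\Gamma_A$ and $\mathfrak b$ is a (possibly empty) simplex of $\Gamma_B$. Homology is reduced homology. *)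

theory Defs
  imports
    "HOL-Algebra.Elementary_Groups"
    "HOL-Library.Disjoint_Sets"
    "HOL-Library.FuncSet"
    "HOL-Library.Z2"
begin

definition abstract_simplicial_complex :: "'v set set \<Rightarrow> bool" where
  "abstract_simplicial_complex \<Gamma> \<longleftrightarrow>
     finite \<Gamma> \<and> (\<forall>\<sigma>\<in>\<Gamma>. finite \<sigma>) \<and> {} \<in> \<Gamma> \<and> (\<forall>\<sigma>\<in>\<Gamma>. \<forall>\<tau>. \<tau> \<subseteq> \<sigma> \<longrightarrow> \<tau> \<in> \<Gamma>)"

definition simplex_dim :: "'v set \<Rightarrow> int" where
  "simplex_dim \<sigma> = int (card \<sigma>) - 1"

text \<open>The complex whose only simplex is the empty one has dimension -1.\<close>

definition complex_dim :: "'v set set \<Rightarrow> int" where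
  "complex_dim \<Gamma> = Max (simplex_dim ` \<Gamma>)"

text \<open>Colours are the numbers from 1 to n; the values of the colouring \<open>A\<close> outside this
  range are irrelevant. Colour classes may be empty.\<close>

definition coloured_complex :: "nat \<Rightarrow> 'v set set \<Rightarrow> (nat \<Rightarrow> 'v set) \<Rightarrow> bool" where
  "coloured_complex n \<Gamma> A \<longleftrightarrow>
     abstract_simplicial_complex \<Gamma> \<and>
     \<Union>\<Gamma> = (\<Union>i\<in>{1..n}. A i) \<and> disjoint_family_on A {1..n} \<and>
     (\<forall>u v. u \<noteq> v \<and> {u, v} \<in> \<Gamma> \<longrightarrow> (\<forall>i\<in>{1..n}. \<not> (u \<in> A i \<and> v \<in> A i)))"

definition discrete_complex :: "'v set \<Rightarrow> 'v set set" where
  "discrete_complex S = insert {} {{v} | v. v \<in> S}"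

text \<open>Meant for complexes with pairwise disjoint vertex sets.\<close>

definition simplicial_join :: "'i set \<Rightarrow> ('i \<Rightarrow> 'v set set) \<Rightarrow> 'v set set" where
  "simplicial_join I \<Delta> = {(\<Union>i\<in>I. \<sigma> i) | \<sigma>. \<forall>i\<in>I. \<sigma> i \<in> \<Delta> i}"

text \<open>Cells of the complete bipartite graph on two vertex sets (made disjoint by the sum
  type), each given by its set of end points.\<close>

definition bipartite_cells :: "'a set \<Rightarrow> 'b set \<Rightarrow> ('a + 'b) set set" where
  "bipartite_cells A B = {{x} | x. x \<in> A <+> B} \<union> {{Inl a, Inr b} | a b. a \<in> A \<and> b \<in> B}"

text \<open>A cube of the product of these graphs is a product of one cell from each factor. It is
  represented by its set of vertices, which determines it, and one cube is a face of another
  iff its vertex set is contained in that of the other.\<close>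

definition product_cubes ::
    "nat \<Rightarrow> (nat \<Rightarrow> 'a set) \<Rightarrow> (nat \<Rightarrow> 'b set) \<Rightarrow> (nat \<Rightarrow> 'a + 'b) set set" where
  "product_cubes n A B =
     {PiE {1..n} e | e. \<forall>i\<in>{1..n}. e i \<in> bipartite_cells (A i) (B i)}"

definition coupled_vertices ::
    "nat \<Rightarrow> 'a set set \<Rightarrow> (nat \<Rightarrow> 'a set) \<Rightarrow> 'b set set \<Rightarrow> (nat \<Rightarrow> 'b set) \<Rightarrow> (nat \<Rightarrow> 'a + 'b) set" where
  "coupled_vertices n \<Gamma>A A \<Gamma>B B =
     {x \<in> PiE {1..n} (\<lambda>i. A i <+> B i).
        {a. \<exists>i\<in>{1..n}. x i = Inl a} \<in> \<Gamma>A \<and> {b. \<exists>i\<in>{1..n}. x i = Inr b} \<in> \<Gamma>B}"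

definition coupled_link_complex ::
    "nat \<Rightarrow> 'a set set \<Rightarrow> (nat \<Rightarrow> 'a set) \<Rightarrow> 'b set set \<Rightarrow> (nat \<Rightarrow> 'b set)
      \<Rightarrow> (nat \<Rightarrow> 'a + 'b) set set" where
  "coupled_link_complex n \<Gamma>A A \<Gamma>B B =
     {Q \<in> product_cubes n A B. Q \<subseteq> coupled_vertices n \<Gamma>A A \<Gamma>B B}"

text \<open>The dimension of a cube is the number of coordinates that vary on it, that is, the number
  of its factors that are edges. The empty set is the cell of dimension -1 used for
  augmentation.\<close>

definition cube_dim :: "('i \<Rightarrow> 'v) set \<Rightarrow> int" where
  "cube_dim Q = (if Q = {} then -1 else int (card {i. \<exists>x\<in>Q. \<exists>y\<in>Q. x i \<noteq> y i}))"

text \<open>Augmented cellular chain complex with coefficients in the field \<open>bit\<close> of two elements.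
  It applies to a finite set \<open>C\<close> of simplices or cubes, given by their vertex sets and
  including the empty cell. Over this field no orientations are needed, and the boundary
  of a cell is the sum of its faces of codimension one. The group in degree -1 is spanned by
  the empty cell, so the homology below is reduced homology.\<close>

definition chain_group :: "'c set set \<Rightarrow> ('c set \<Rightarrow> int) \<Rightarrow> int \<Rightarrow> ('c set \<Rightarrow> bit) monoid" where
  "chain_group C dm p =
     \<lparr>carrier = {c. \<forall>\<sigma>. c \<sigma> \<noteq> 0 \<longrightarrow> \<sigma> \<in> C \<and> dm \<sigma> = p},
      monoid.mult = (\<lambda>c d \<sigma>. c \<sigma> + d \<sigma>),
      one = (\<lambda>\<sigma>. 0)\<rparr>"

definition chain_boundary ::
    "'c set set \<Rightarrow> ('c set \<Rightarrow> int) \<Rightarrow> int \<Rightarrow> ('c set \<Rightarrow> bit) \<Rightarrow> ('c set \<Rightarrow> bit)" where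
  "chain_boundary C dm p c =
     (\<lambda>\<tau>. if \<tau> \<in> C \<and> dm \<tau> = p - 1 then (\<Sum>\<sigma> | \<sigma> \<in> C \<and> dm \<sigma> = p \<and> \<tau> \<subset> \<sigma>. c \<sigma>) else 0)"

definition cell_homology :: "'c set set \<Rightarrow> ('c set \<Rightarrow> int) \<Rightarrow> int \<Rightarrow> ('c set \<Rightarrow> bit) set monoid" where
  "cell_homology C dm p =
     (chain_group C dm p)
       \<lparr>carrier := kernel (chain_group C dm p) (chain_group C dm (p - 1)) (chain_boundary C dm p)\<rparr>
     Mod (chain_boundary C dm (p + 1) ` carrier (chain_group C dm (p + 1)))"

definition simplicial_homology :: "int \<Rightarrow> 'v set set \<Rightarrow> ('v set \<Rightarrow> bit) set monoid" where
  "simplicial_homology p \<Gamma> = cell_homology \<Gamma> simplex_dim p"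

definition cubical_homology :: "int \<Rightarrow> ('i \<Rightarrow> 'v) set set \<Rightarrow> (('i \<Rightarrow> 'v) set \<Rightarrow> bit) set monoid" where
  "cubical_homology p X = cell_homology (insert {} X) cube_dim p"

end

theory Submission
  imports Defs "HOL-Combinatorics.Transposition"
begin

text \<open>The vertices of a cube of the coupled link complex include one whose \<open>A\<close>-part is
  the set of all \<open>A\<close>-vertices on the cube. This set is a simplex of \<open>\<Gamma>A\<close> and has at
  least as many elements as the cube has varying coordinates, so there are no cubes of dimension
  \<open>k + 2\<close>, and it suffices to find a nonzero cycle of dimension \<open>k + 1\<close>. Choose two points
  in each \<open>B i\<close> and let \<open>z\<close> be a nonzero \<open>k\<close>-cycle of \<open>\<Gamma>A\<close>. Give a \<open>(k+1)\<close>-cube that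
  involves only the chosen points the coefficient of \<open>z\<close> at the set of all its \<open>A\<close>-vertices.
  Every coordinate of such a cube contains a chosen point. If a coordinate of a \<open>k\<close>-cube is a
  single \<open>A\<close>-vertex, exchanging the two chosen points there pairs off the cubes around it;
  otherwise the cubes around it correspond to the simplices of \<open>\<Gamma>A\<close> around its set of
  \<open>A\<close>-vertices, and their coefficients cancel because \<open>z\<close> is a cycle.\<close>

section \<open>Cancellation modulo 2 and homology in the top degree\<close>

text \<open>The involution splits \<open>S\<close> into pairs, and the two equal terms of a pair add
  up to 0 in \<open>bit\<close>. For infinite \<open>S\<close> the sum is 0 by convention.\<close>

lemma sum_bit_involution:
  fixes g :: "'c \<Rightarrow> bit"
  assumes "\<And>x. x \<in> S \<Longrightarrow> f x \<in> S" "\<And>x. x \<in> S \<Longrightarrow> f (f x) = x"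
    and "\<And>x. x \<in> S \<Longrightarrow> f x \<noteq> x" "\<And>x. x \<in> S \<Longrightarrow> g (f x) = g x"
  shows "sum g S = 0"
proof (cases "finite S")
  case True
  then show ?thesis
    using assms
  proof (induction S rule: finite_psubset_induct)
    case (psubset S)
    show ?case
    proof (cases "S = {}")
      case False
      then obtain x where x: "x \<in> S" by blast
      let ?T = "S - {x, f x}"
      have "sum g ?T = 0"
        using x psubset.prems by (intro psubset.IH) (auto, metis+)
      moreover have "S = insert x (insert (f x) ?T)"
        using x psubset.prems(1) by auto
      then have "sum g S = sum g (insert x (insert (f x) ?T))" by simp
      moreover have "\<dots> = g x + (g (f x) + sum g ?T)"
        using psubset.hyps psubset.prems(3)[OF x] by (subst sum.insert) auto
      ultimately show ?thesis
        using psubset.prems(4)[OF x] by simp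
    qed simp
  qed
qed simp

text \<open>With no cells in degree \<open>p + 1\<close> the only boundary is 0, so every homology
  class is a singleton and homology amounts to the set of cycles. This serves both to extract a
  cycle from \<Gamma>A and to conclude from a cycle of cubes.\<close>

lemma trivial_cell_homology_top:
  assumes top: "\<And>\<sigma>. \<sigma> \<in> C \<Longrightarrow> dm \<sigma> \<noteq> p + 1"
  shows "trivial_group (cell_homology C dm p) \<longleftrightarrow>
    (\<forall>c\<in>carrier (chain_group C dm p). chain_boundary C dm p c = (\<lambda>_. 0) \<longrightarrow> c = (\<lambda>_. 0))"
    (is "?triv \<longleftrightarrow> ?zero")
proof -
  let ?Z = "{c \<in> carrier (chain_group C dm p). chain_boundary C dm p c = (\<lambda>_. 0)}"
  have carr: "carrier (chain_group C dm (p + 1)) = {\<lambda>_. 0}"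
    using top by (fastforce simp: chain_group_def)
  have im: "chain_boundary C dm (p + 1) ` carrier (chain_group C dm (p + 1)) = {\<lambda>_. 0}"
    unfolding carr by (auto simp: chain_boundary_def)
  have zero: "(\<lambda>_. 0) \<in> ?Z"
    by (auto simp: chain_group_def chain_boundary_def)
  have coset: "{\<lambda>_. 0} #>\<^bsub>chain_group C dm p\<^esub> c = {c}" for c
    unfolding r_coset_def chain_group_def monoid.simps partial_object.simps
    by (simp only: UN_insert UN_empty Un_empty_right add_0_left monoid.simps partial_object.simps)
  have ker: "kernel (chain_group C dm p) (chain_group C dm (p - 1)) (chain_boundary C dm p) = ?Z"
    by (simp add: kernel_def chain_group_def)
  have carrier: "carrier (cell_homology C dm p) = (\<lambda>c. {c}) ` ?Z"
    unfolding cell_homology_def im ker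
    by (simp add: FactGroup_def RCOSETS_def coset UNION_singleton_eq_range)
  have one: "one (cell_homology C dm p) = {\<lambda>_. 0}"
    unfolding cell_homology_def im by (simp add: FactGroup_def)
  have mult: "{\<lambda>_. 0} \<otimes>\<^bsub>cell_homology C dm p\<^esub> {\<lambda>_. 0} = {\<lambda>_. 0}"
    unfolding cell_homology_def im
    by (auto simp: FactGroup_def set_mult_def chain_group_def)
  show ?thesis
  proof
    assume ?triv
    then have "(\<lambda>c. {c}) ` ?Z = {{\<lambda>_. 0}}"
      unfolding trivial_group_def carrier one by simp
    then show ?zero by blast
  next
    assume ?zero
    then have "?Z = {\<lambda>_. 0}"
      using zero by blast
    then have c: "carrier (cell_homology C dm p) = {{\<lambda>_. 0}}"
      unfolding carrier by simp
    \<comment> \<open>Only one class is left, so the group axioms reduce to the single product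
      \<open>mult\<close>.\<close>
    have "group (cell_homology C dm p)"
      by (rule groupI) (auto simp: c one mult)
    then show ?triv
      unfolding trivial_group_def by (simp add: c one)
  qed
qed

section \<open>Cubes described by their factors: faces, dimension and A-vertices\<close>

text \<open>This form treats vertices and edges alike, so that passing to a face or adding an end
  point needs no case distinction.\<close>

lemma bipartite_cells_iff:
  "c \<in> bipartite_cells A B \<longleftrightarrow> c \<noteq> {} \<and> c \<subseteq> A <+> B \<and>
     (\<forall>a a'. Inl a \<in> c \<and> Inl a' \<in> c \<longrightarrow> a = a') \<and>
     (\<forall>b b'. Inr b \<in> c \<and> Inr b' \<in> c \<longrightarrow> b = b')" (is "_ \<longleftrightarrow> ?R")
proof
  assume "c \<in> bipartite_cells A B"
  then show ?R by (auto simp: bipartite_cells_def)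
next
  assume R: ?R
  consider a b where "Inl a \<in> c" "Inr b \<in> c" | a where "Inl a \<in> c" "\<forall>b. Inr b \<notin> c"
    | b where "Inr b \<in> c" "\<forall>a. Inl a \<notin> c"
    using R by (metis all_not_in_conv sumE)
  then show "c \<in> bipartite_cells A B"
  proof cases
    case 1
    have "x \<in> c \<longleftrightarrow> x \<in> {Inl a, Inr b}" for x
      using R 1 by (cases x) auto
    then have "c = {Inl a, Inr b}" by blast
    moreover have "a \<in> A" "b \<in> B" using R 1 by auto
    ultimately show ?thesis unfolding bipartite_cells_def by blast
  next
    case 2
    have "x \<in> c \<longleftrightarrow> x \<in> {Inl a}" for x
      using R 2 by (cases x) auto
    then have "c = {Inl a}" by blast
    then show ?thesis using R by (simp add: bipartite_cells_def)
  next
    case 3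
    have "x \<in> c \<longleftrightarrow> x \<in> {Inr b}" for x
      using R 3 by (cases x) auto
    then have "c = {Inr b}" by blast
    then show ?thesis using R by (simp add: bipartite_cells_def)
  qed
qed

lemma bipartite_cells_subset:
  assumes "c \<in> bipartite_cells A B" "d \<subseteq> c" "d \<noteq> {}"
  shows "d \<in> bipartite_cells A B"
proof -
  have c: "c \<subseteq> A <+> B" "\<And>a a'. Inl a \<in> c \<Longrightarrow> Inl a' \<in> c \<Longrightarrow> a = a'"
      "\<And>b b'. Inr b \<in> c \<Longrightarrow> Inr b' \<in> c \<Longrightarrow> b = b'"
    using assms(1) by (simp_all add: bipartite_cells_iff)
  show ?thesis
    unfolding bipartite_cells_iff
    using assms(3) subset_trans[OF assms(2) c(1)] c(2,3) subsetD[OF assms(2)] by meson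
qed

text \<open>The families are extensional so that a cube determines its family of factors.\<close>

definition cube_factors ::
    "'i set \<Rightarrow> ('i \<Rightarrow> 'a set) \<Rightarrow> ('i \<Rightarrow> 'b set) \<Rightarrow> ('i \<Rightarrow> ('a + 'b) set) set" where
  "cube_factors I A B = (\<Pi>\<^sub>E i\<in>I. bipartite_cells (A i) (B i))"

text \<open>Reads the factors of a cube off its vertex set, which is all that a chain on cubes can
  see.\<close>

definition coord :: "('i \<Rightarrow> 'v) set \<Rightarrow> 'i \<Rightarrow> 'v set" where
  "coord Q i = (\<lambda>x. x i) ` Q"

text \<open>For a cube with factors \<open>e\<close> this is the largest A-part of a vertex of the
  cube, attained by taking the A-end of each factor that has one.\<close>

definition left_vertices :: "'i set \<Rightarrow> ('i \<Rightarrow> ('a + 'b) set) \<Rightarrow> 'a set" where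
  "left_vertices I e = {a. \<exists>i\<in>I. Inl a \<in> e i}"

lemma left_vertices_cong: "(\<And>i. i \<in> I \<Longrightarrow> e i = e' i) \<Longrightarrow> left_vertices I e = left_vertices I e'"
  by (simp add: left_vertices_def)

lemma cube_factors_nonempty:
  assumes "e \<in> cube_factors I A B"
  shows "PiE I e \<noteq> {}"
  using assms by (auto simp: cube_factors_def PiE_iff bipartite_cells_iff PiE_eq_empty_iff)

lemma coord_PiE:
  assumes "e \<in> cube_factors I A B" "i \<in> I"
  shows "coord (PiE I e) i = e i"
  using assms cube_factors_nonempty[OF assms(1)]
  by (simp add: coord_def image_projection_PiE PiE_eq_empty_iff)

lemma left_vertices_coord:
  assumes "e \<in> cube_factors I A B"
  shows "left_vertices I (coord (PiE I e)) = left_vertices I e"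
  using coord_PiE[OF assms] by (intro left_vertices_cong)

lemma PiE_le_iff:
  assumes "e \<in> cube_factors I A B"
  shows "PiE I e \<subseteq> PiE I e' \<longleftrightarrow> (\<forall>i\<in>I. e i \<subseteq> e' i)"
  using cube_factors_nonempty[OF assms] by (simp add: subset_PiE)

lemma cube_dim_PiE:
  assumes e: "e \<in> cube_factors I A B"
  shows "cube_dim (PiE I e) = int (card {i\<in>I. (\<exists>a. Inl a \<in> e i) \<and> (\<exists>b. Inr b \<in> e i)})"
proof -
  have "(\<exists>x\<in>PiE I e. \<exists>y\<in>PiE I e. x i \<noteq> y i) \<longleftrightarrow> i \<in> I \<and> (\<exists>a. Inl a \<in> e i) \<and> (\<exists>b. Inr b \<in> e i)"
    for i
  proof (cases "i \<in> I")
    case True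
    have "(\<exists>x\<in>PiE I e. \<exists>y\<in>PiE I e. x i \<noteq> y i) \<longleftrightarrow>
        (\<exists>u\<in>coord (PiE I e) i. \<exists>v\<in>coord (PiE I e) i. u \<noteq> v)"
      by (auto simp: coord_def)
    also have "\<dots> \<longleftrightarrow> (\<exists>u\<in>e i. \<exists>v\<in>e i. u \<noteq> v)"
      using coord_PiE[OF e True] by simp
    also have "\<dots> \<longleftrightarrow> (\<exists>a. Inl a \<in> e i) \<and> (\<exists>b. Inr b \<in> e i)"
    proof -
      have "e i \<in> bipartite_cells (A i) (B i)"
        using e True by (simp add: cube_factors_def PiE_iff)
      then show ?thesis
        by (auto simp: bipartite_cells_def)
    qed
    finally show ?thesis using True by simp
  next
    case False
    \<comment> \<open>Outside \<open>I\<close> all points of the product are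
      \<open>undefined\<close>, so nothing varies there.\<close>
    then show ?thesis by (metis PiE_arb)
  qed
  then show ?thesis
    using cube_factors_nonempty[OF e] by (simp add: cube_dim_def)
qed

text \<open>A factor has at most one A-end, and A-ends of different factors differ because the
  colour classes are disjoint.\<close>

lemma card_left_vertices:
  assumes e: "e \<in> cube_factors I A B" and disj: "disjoint_family_on A I"
  shows "card (left_vertices I e) = card {i\<in>I. \<exists>a. Inl a \<in> e i}"
proof -
  let ?L = "{i\<in>I. \<exists>a. Inl a \<in> e i}"
  have "\<forall>i\<in>?L. \<exists>a. Inl a \<in> e i" by simp
  then obtain f where f: "\<And>i. i \<in> ?L \<Longrightarrow> Inl (f i) \<in> e i"
    by metis
  have cell: "e i \<in> bipartite_cells (A i) (B i)" if "i \<in> I" for i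
    using e that by (simp add: cube_factors_def PiE_iff)
  have "left_vertices I e = f ` ?L"
    using f cell by (fastforce simp: left_vertices_def bipartite_cells_iff)
  moreover have "f i \<in> A i" if "i \<in> ?L" for i
    using f[OF that] cell[of i] that by (auto simp: bipartite_cells_iff)
  then have "inj_on f ?L"
    using disj by (intro inj_onI) (fastforce simp: disjoint_family_on_def)
  ultimately show ?thesis
    by (simp add: card_image)
qed

lemma cube_dim_le_card:
  assumes "e \<in> cube_factors I A B" "disjoint_family_on A I" "finite I"
  shows "cube_dim (PiE I e) \<le> int (card (left_vertices I e))"
  unfolding cube_dim_PiE[OF assms(1)] card_left_vertices[OF assms(1,2)]
  using assms(3) by (intro of_nat_mono card_mono) auto

text \<open>The dimension counts the edges among the factors with an A-end; such a factor fails to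
  be an edge exactly when it is a single A-vertex.\<close>

lemma cube_dim_eq_card_iff:
  assumes e: "e \<in> cube_factors I A B" and disj: "disjoint_family_on A I" and fin: "finite I"
  shows "cube_dim (PiE I e) = int (card (left_vertices I e)) \<longleftrightarrow> (\<forall>i\<in>I. \<exists>b. Inr b \<in> e i)"
proof -
  let ?D = "{i\<in>I. (\<exists>a. Inl a \<in> e i) \<and> (\<exists>b. Inr b \<in> e i)}" and ?L = "{i\<in>I. \<exists>a. Inl a \<in> e i}"
  have "card ?D = card ?L \<longleftrightarrow> ?D = ?L"
  proof
    assume "card ?D = card ?L"
    then show "?D = ?L" using fin by (intro card_subset_eq) auto
  qed simp
  also have "\<dots> \<longleftrightarrow> (\<forall>i\<in>I. \<exists>b. Inr b \<in> e i)"
  proof -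
    have "\<exists>x. x \<in> e i" if "i \<in> I" for i
      using e that by (auto simp: cube_factors_def PiE_iff bipartite_cells_iff)
    then have "(\<exists>a. Inl a \<in> e i) \<or> (\<exists>b. Inr b \<in> e i)" if "i \<in> I" for i
      using that by (metis sumE)
    then show ?thesis by auto
  qed
  finally show ?thesis
    by (simp add: cube_dim_PiE[OF e] card_left_vertices[OF e disj])
qed

section \<open>The coupled link complex when \<Gamma>B is a join of discrete sets\<close>

text \<open>The B-part of any vertex of the product has at most one element in each coordinate, so
  it is always a simplex of the join. As \<Gamma>A is closed under subsets, the condition on A-parts
  need only be tested at the largest one.\<close>

lemma coupled_link_complex_join:
  assumes \<Gamma>A: "abstract_simplicial_complex \<Gamma>A"
    and \<Gamma>B: "\<Gamma>B = simplicial_join {1..n} (\<lambda>i. discrete_complex (B i))"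
  shows "coupled_link_complex n \<Gamma>A A \<Gamma>B B =
    PiE {1..n} ` {e \<in> cube_factors {1..n} A B. left_vertices {1..n} e \<in> \<Gamma>A}"
proof -
  let ?I = "{1..n}"
  have "PiE ?I e \<subseteq> coupled_vertices n \<Gamma>A A \<Gamma>B B \<longleftrightarrow> left_vertices ?I e \<in> \<Gamma>A"
    if e: "e \<in> cube_factors ?I A B" for e
  proof
    assume sub: "PiE ?I e \<subseteq> coupled_vertices n \<Gamma>A A \<Gamma>B B"
    \<comment> \<open>The vertex \<open>x\<close> takes the A-end wherever there is one, so its
      A-part is all of \<open>left_vertices ?I e\<close>.\<close>
    have "\<exists>x. x \<in> e i \<and> ((\<exists>a. Inl a \<in> e i) \<longrightarrow> (\<exists>a. x = Inl a))" if "i \<in> ?I" for i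
    proof (cases "\<exists>a. Inl a \<in> e i")
      case False
      have "e i \<noteq> {}"
        using e that by (auto simp: cube_factors_def PiE_iff bipartite_cells_iff)
      then show ?thesis using False by auto
    qed auto
    then obtain x where x: "\<And>i. i \<in> ?I \<Longrightarrow> x i \<in> e i"
      "\<And>i. i \<in> ?I \<Longrightarrow> (\<exists>a. Inl a \<in> e i) \<Longrightarrow> (\<exists>a. x i = Inl a)"
      by metis
    have "restrict x ?I \<in> PiE ?I e"
      using x by simp
    then have "restrict x ?I \<in> coupled_vertices n \<Gamma>A A \<Gamma>B B"
      using sub by blast
    then have "{a. \<exists>i\<in>?I. restrict x ?I i = Inl a} \<in> \<Gamma>A"
      unfolding coupled_vertices_def by blast
    moreover have "x i = Inl a \<longleftrightarrow> Inl a \<in> e i" if i: "i \<in> ?I" for i a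
    proof
      assume a: "Inl a \<in> e i"
      then obtain a' where a': "x i = Inl a'" using x(2)[OF i] by blast
      then have "Inl a' \<in> e i" using x(1)[OF i] by simp
      then show "x i = Inl a"
        using e i a a' by (auto simp: cube_factors_def PiE_iff bipartite_cells_iff)
    qed (use x(1)[OF i] in simp)
    then have "{a. \<exists>i\<in>?I. restrict x ?I i = Inl a} = left_vertices ?I e"
      unfolding left_vertices_def by (intro Collect_cong bex_cong) simp_all
    ultimately show "left_vertices ?I e \<in> \<Gamma>A" by simp
  next
    assume left: "left_vertices ?I e \<in> \<Gamma>A"
    show "PiE ?I e \<subseteq> coupled_vertices n \<Gamma>A A \<Gamma>B B"
    proof
      fix x assume x: "x \<in> PiE ?I e"
      have sub: "e i \<subseteq> A i <+> B i" if "i \<in> ?I" for i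
        using e that by (simp add: cube_factors_def PiE_iff bipartite_cells_iff)
      have xAB: "x \<in> PiE ?I (\<lambda>i. A i <+> B i)"
        by (rule subsetD[OF PiE_mono[OF sub] x])
      have "{a. \<exists>i\<in>?I. x i = Inl a} \<subseteq> left_vertices ?I e"
        using PiE_mem[OF x] by (fastforce simp: left_vertices_def)
      then have "{a. \<exists>i\<in>?I. x i = Inl a} \<in> \<Gamma>A"
        using left \<Gamma>A unfolding abstract_simplicial_complex_def by blast
      moreover have "{b. \<exists>i\<in>?I. x i = Inr b} \<in> \<Gamma>B"
        unfolding \<Gamma>B simplicial_join_def
      proof (intro CollectI exI conjI ballI)
        \<comment> \<open>The witness for the join assigns to colour \<open>i\<close> the B-vertex
          of \<open>x\<close> at \<open>i\<close>, or the empty simplex if there is none.\<close>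
        show "{b. \<exists>i\<in>?I. x i = Inr b} = (\<Union>i\<in>?I. {b. x i = Inr b})" by blast
        fix i assume "i \<in> ?I"
        then have "x i \<in> A i <+> B i" using xAB by (simp add: PiE_iff)
        then show "{b. x i = Inr b} \<in> discrete_complex (B i)"
          by (auto simp: discrete_complex_def)
      qed
      ultimately show "x \<in> coupled_vertices n \<Gamma>A A \<Gamma>B B"
        using xAB by (simp add: coupled_vertices_def)
    qed
  qed
  moreover have "product_cubes n A B = PiE ?I ` cube_factors ?I A B"
  proof (intro subset_antisym subsetI)
    fix Q assume "Q \<in> product_cubes n A B"
    then obtain e where e: "Q = PiE ?I e" "\<forall>i\<in>?I. e i \<in> bipartite_cells (A i) (B i)"
      unfolding product_cubes_def by blast
    have "Q = PiE ?I (restrict e ?I)"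
      unfolding e(1) by (intro PiE_cong) simp
    moreover have "restrict e ?I \<in> cube_factors ?I A B"
      using e(2) by (simp add: cube_factors_def)
    ultimately show "Q \<in> PiE ?I ` cube_factors ?I A B" by blast
  next
    fix Q assume "Q \<in> PiE ?I ` cube_factors ?I A B"
    then show "Q \<in> product_cubes n A B"
      unfolding product_cubes_def cube_factors_def PiE_iff by blast
  qed
  ultimately show ?thesis
    unfolding coupled_link_complex_def by auto
qed

lemma inj_on_PiE_cube_factors: "inj_on (PiE I) (cube_factors I A B)"
proof (rule inj_onI)
  fix e e' assume e: "e \<in> cube_factors I A B" "e' \<in> cube_factors I A B" "PiE I e = PiE I e'"
  have "e i = e' i" if "i \<in> I" for i
    using coord_PiE[OF e(1) that] coord_PiE[OF e(2) that] e(3) by simp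
  then show "e = e'"
    using e(1,2) unfolding cube_factors_def by (rule PiE_ext[rotated 2])
qed

text \<open>If \<open>\<Gamma>\<close> has dimension at most \<open>k\<close>, these are the factors of the cubes of dimension
  \<open>k + 1\<close> around the cube with factors \<open>t\<close>; taking \<open>t\<close> constantly empty stands for the
  empty cell.\<close>

definition top_factors ::
    "'i set \<Rightarrow> ('i \<Rightarrow> 'a set) \<Rightarrow> ('i \<Rightarrow> 'b set) \<Rightarrow> 'a set set \<Rightarrow> int \<Rightarrow> ('i \<Rightarrow> ('a + 'b) set)
      \<Rightarrow> ('i \<Rightarrow> ('a + 'b) set) set" where
  "top_factors I A B \<Gamma> k t =
     {e \<in> cube_factors I A B. left_vertices I e \<in> \<Gamma> \<and> int (card (left_vertices I e)) = k + 1 \<and>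
        (\<forall>i\<in>I. (\<exists>b. Inr b \<in> e i) \<and> t i \<subseteq> e i)}"

section \<open>The two kinds of cancellation around a cube\<close>

text \<open>Exchanging \<open>b\<close> and \<open>b'\<close> in factor \<open>i\<close> respects
  \<open>t i \<subseteq> e i\<close>, since \<open>t i\<close> has no B-vertex, and leaves the
  A-vertices alone. It moves every \<open>e\<close>, because \<open>e i\<close> contains exactly one
  of the two points. The empty cell, with all \<open>t i\<close> empty, is covered as well.\<close>

lemma sum_top_factors_exchange:
  fixes z :: "'a set \<Rightarrow> bit" and B :: "'i \<Rightarrow> 'b set"
  assumes i: "i \<in> I" "\<And>b. Inr b \<notin> t i" and B: "B i = {b, b'}" "b \<noteq> b'"
  shows "(\<Sum>e\<in>top_factors I A B \<Gamma> k t. z (left_vertices I e)) = 0"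
proof -
  define h :: "'a + 'b \<Rightarrow> 'a + 'b" where "h = map_sum id (transpose b b')"
  have h[simp]: "h (h x) = x" "h x = Inl a \<longleftrightarrow> x = Inl a" "Inl a = h x \<longleftrightarrow> x = Inl a"
      "h (Inr c) = Inr (transpose b b' c)" "h (Inl a) = Inl a" for x a c
    by (cases x; auto simp: h_def)+
  have hh: "h ` h ` c = c" for c
    by (simp add: image_image)
  have Inl: "Inl a \<in> h ` c \<longleftrightarrow> Inl a \<in> c" for a c
    by auto
  have Inr: "Inr d \<in> h ` c \<longleftrightarrow> Inr (transpose b b' d) \<in> c" for d c
    by (metis hh h(4) imageI transpose_involutory)
  let ?f = "\<lambda>e. e(i := h ` e i)"
  have left: "left_vertices I (?f e) = left_vertices I e" for e
    by (auto simp: left_vertices_def Inl)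
  show ?thesis
  proof (rule sum_bit_involution[where f = ?f])
    fix e assume e: "e \<in> top_factors I A B \<Gamma> k t"
    then have ei: "e i \<in> bipartite_cells (A i) {b, b'}"
      using i B by (auto simp: top_factors_def cube_factors_def PiE_iff)
    have "h ` e i \<in> bipartite_cells (A i) {b, b'}"
    proof -
      have "h ` e i \<subseteq> A i <+> {b, b'}"
      proof
        fix x assume "x \<in> h ` e i"
        then show "x \<in> A i <+> {b, b'}"
          using ei by (cases x) (auto simp: bipartite_cells_iff transpose_def)
      qed
      moreover have "c = d" if "Inr c \<in> h ` e i" "Inr d \<in> h ` e i" for c d
        using that ei unfolding Inr bipartite_cells_iff by (metis transpose_involutory)
      ultimately show ?thesis
        using ei unfolding bipartite_cells_iff Inl by blast
    qed
    then have "?f e \<in> cube_factors I A B"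
      using e i(1) B(1) by (auto simp: top_factors_def cube_factors_def PiE_iff extensional_def)
    moreover have "t i \<subseteq> h ` e i"
    proof
      fix x assume "x \<in> t i"
      moreover then obtain a where "x = Inl a" using i(2) by (cases x) auto
      ultimately show "x \<in> h ` e i" using e i(1) by (auto simp: top_factors_def Inl)
    qed
    moreover obtain c where c: "Inr c \<in> e i"
      using e i(1) by (auto simp: top_factors_def)
    then have "Inr (transpose b b' c) \<in> h ` e i"
      by (simp add: Inr)
    ultimately show "?f e \<in> top_factors I A B \<Gamma> k t"
      using e by (auto simp: top_factors_def left)
    show "?f (?f e) = e"
      by (simp add: hh)
    show "?f e \<noteq> e"
    proof
      assume "?f e = e"
      then have "h ` e i = e i" by (metis fun_upd_same)
      then have "Inr (transpose b b' c) \<in> e i"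
        using c by (metis h(4) imageI)
      then have "transpose b b' c = c" using c ei by (auto simp: bipartite_cells_iff)
      moreover have "c = b \<or> c = b'" using c ei by (auto simp: bipartite_cells_iff)
      ultimately show False using B(2) by auto
    qed
    show "z (left_vertices I (?f e)) = z (left_vertices I e)"
      by (simp only: left)
  qed
qed

lemma coloured_complexD:
  assumes "coloured_complex n \<Gamma> A"
  shows "abstract_simplicial_complex \<Gamma>" "disjoint_family_on A {1..n}"
    "\<And>\<sigma>. \<sigma> \<in> \<Gamma> \<Longrightarrow> \<sigma> \<subseteq> (\<Union>i\<in>{1..n}. A i)"
    "\<And>\<sigma> i u v. \<lbrakk>\<sigma> \<in> \<Gamma>; i \<in> {1..n}; u \<in> \<sigma> \<inter> A i; v \<in> \<sigma> \<inter> A i\<rbrakk> \<Longrightarrow> u = v"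
proof -
  note * = assms[unfolded coloured_complex_def]
  show cplx: "abstract_simplicial_complex \<Gamma>" and "disjoint_family_on A {1..n}"
    using * by auto
  show "\<sigma> \<subseteq> (\<Union>i\<in>{1..n}. A i)" if "\<sigma> \<in> \<Gamma>" for \<sigma>
    using * that by blast
  show "u = v" if "\<sigma> \<in> \<Gamma>" "i \<in> {1..n}" "u \<in> \<sigma> \<inter> A i" "v \<in> \<sigma> \<inter> A i" for \<sigma> i u v
  proof -
    have "{u, v} \<in> \<Gamma>"
      using cplx that unfolding abstract_simplicial_complex_def by (metis IntD1 empty_subsetI insert_subset)
    then show ?thesis using * that by blast
  qed
qed

text \<open>Each vertex of \<sigma> missing from \<open>t\<close> is added to the factor of its
  colour. The factors remain cells because \<sigma> has at most one vertex of each colour and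
  already contains the A-vertices of \<open>t\<close>.\<close>

lemma
  assumes col: "coloured_complex n \<Gamma> A" and t: "t \<in> cube_factors {1..n} A B"
    and Inr: "\<And>i. i \<in> {1..n} \<Longrightarrow> \<exists>b. Inr b \<in> t i"
    and \<sigma>: "\<sigma> \<in> \<Gamma>" "left_vertices {1..n} t \<subseteq> \<sigma>"
  defines "e \<equiv> restrict (\<lambda>i. t i \<union> Inl ` (\<sigma> \<inter> A i)) {1..n}"
  shows cube_factors_extend: "e \<in> cube_factors {1..n} A B"
    and left_vertices_extend: "left_vertices {1..n} e = \<sigma>"
proof -
  have ti: "t i \<in> bipartite_cells (A i) (B i)" if "i \<in> {1..n}" for i
    using t that by (simp add: cube_factors_def PiE_iff)
  have tA: "a \<in> \<sigma> \<inter> A i" if "i \<in> {1..n}" "Inl a \<in> t i" for a i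
  proof -
    have "a \<in> A i" using ti[OF that(1)] that(2) by (auto simp: bipartite_cells_iff)
    moreover have "a \<in> left_vertices {1..n} t" using that unfolding left_vertices_def by blast
    ultimately show ?thesis using \<sigma>(2) by blast
  qed
  have "t i \<union> Inl ` (\<sigma> \<inter> A i) \<in> bipartite_cells (A i) (B i)" if i: "i \<in> {1..n}" for i
  proof -
    let ?c = "t i \<union> Inl ` (\<sigma> \<inter> A i)"
    have c: "t i \<noteq> {}" "t i \<subseteq> A i <+> B i"
        "\<And>b b'. Inr b \<in> t i \<Longrightarrow> Inr b' \<in> t i \<Longrightarrow> b = b'"
      using ti[OF i] by (simp_all add: bipartite_cells_iff)
    have "Inl a \<in> ?c \<longleftrightarrow> a \<in> \<sigma> \<inter> A i" "Inr b \<in> ?c \<longleftrightarrow> Inr b \<in> t i" for a b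
      using tA[OF i] by auto
    moreover have "?c \<noteq> {}" "?c \<subseteq> A i <+> B i"
      using c(1,2) by auto
    ultimately show ?thesis
      unfolding bipartite_cells_iff using c(3) coloured_complexD(4)[OF col \<sigma>(1) i]
      by (simp only: simp_thms) meson
  qed
  then show "e \<in> cube_factors {1..n} A B"
    by (simp add: e_def cube_factors_def)
  have "left_vertices {1..n} e = (\<Union>i\<in>{1..n}. \<sigma> \<inter> A i)"
    using tA by (auto simp: left_vertices_def e_def)
  then show "left_vertices {1..n} e = \<sigma>"
    using coloured_complexD(3)[OF col \<sigma>(1)] by blast
qed

text \<open>A cube around \<open>t\<close> has the same B-ends as \<open>t\<close>, so it is
  determined by its A-vertices; \<open>left_vertices\<close> and the extension by \<sigma> are
  mutually inverse. The right-hand side has the form of a boundary coefficient of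
  \<open>z\<close>.\<close>

lemma sum_top_factors_link:
  fixes z :: "'a set \<Rightarrow> bit"
  assumes col: "coloured_complex n \<Gamma> A" and t: "t \<in> cube_factors {1..n} A B"
    and Inr: "\<And>i. i \<in> {1..n} \<Longrightarrow> \<exists>b. Inr b \<in> t i"
    and card: "int (card (left_vertices {1..n} t)) = k"
  shows "(\<Sum>e\<in>top_factors {1..n} A B \<Gamma> k t. z (left_vertices {1..n} e)) =
    (\<Sum>\<sigma> | \<sigma> \<in> \<Gamma> \<and> simplex_dim \<sigma> = k \<and> left_vertices {1..n} t \<subset> \<sigma>. z \<sigma>)"
proof (rule sum.reindex_bij_witness[where j = "left_vertices {1..n}" and
      i = "\<lambda>\<sigma>. restrict (\<lambda>i. t i \<union> Inl ` (\<sigma> \<inter> A i)) {1..n}"])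
  let ?I = "{1..n}"
  fix e assume e: "e \<in> top_factors ?I A B \<Gamma> k t"
  then have ecell: "e i \<in> bipartite_cells (A i) (B i)" if "i \<in> ?I" for i
    using that by (simp add: top_factors_def cube_factors_def PiE_iff)
  have te: "t i \<subseteq> e i" if "i \<in> ?I" for i
    using e that by (simp add: top_factors_def)
  have "left_vertices ?I t \<subseteq> left_vertices ?I e"
    using te unfolding left_vertices_def by blast
  moreover have left: "left_vertices ?I e \<in> \<Gamma>" "int (card (left_vertices ?I e)) = k + 1"
    using e by (simp_all add: top_factors_def)
  then have "left_vertices ?I t \<noteq> left_vertices ?I e"
    using card by force
  ultimately show "left_vertices ?I e \<in> {\<sigma>. \<sigma> \<in> \<Gamma> \<and> simplex_dim \<sigma> = k \<and> left_vertices ?I t \<subset> \<sigma>}"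
    using left by (simp add: simplex_dim_def psubset_eq)
  show "restrict (\<lambda>i. t i \<union> Inl ` (left_vertices ?I e \<inter> A i)) ?I = e"
  proof
    fix i
    show "restrict (\<lambda>i. t i \<union> Inl ` (left_vertices ?I e \<inter> A i)) ?I i = e i"
    proof (cases "i \<in> ?I")
      case i: True
      have "x \<in> t i \<union> Inl ` (left_vertices ?I e \<inter> A i) \<longleftrightarrow> x \<in> e i" for x
      proof (cases x)
        case (Inl a)
        \<comment> \<open>Disjointness of the colour classes confines an A-vertex of colour
          \<open>i\<close> to factor \<open>i\<close>.\<close>
        have "j = i" if "j \<in> ?I" "Inl a \<in> e j" "a \<in> A i" for j
        proof -
          have "a \<in> A j" using ecell[OF that(1)] that(2) by (auto simp: bipartite_cells_iff)
          then show ?thesis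
            using coloured_complexD(2)[OF col] that i unfolding disjoint_family_on_def by blast
        qed
        moreover have "a \<in> A i" if "Inl a \<in> e i"
          using ecell[OF i] that by (auto simp: bipartite_cells_iff)
        ultimately have "a \<in> left_vertices ?I e \<inter> A i \<longleftrightarrow> Inl a \<in> e i"
          using i unfolding left_vertices_def by blast
        then show ?thesis using te[OF i] Inl by auto
      next
        case (Inr b)
        \<comment> \<open>The B-end of \<open>t i\<close> is also the only one that
          \<open>e i\<close> can have.\<close>
        obtain b' where "Inr b' \<in> t i" using assms(3)[OF i] by blast
        then have "Inr b \<in> e i \<Longrightarrow> b = b'"
          using te[OF i] ecell[OF i] unfolding bipartite_cells_iff by blast
        then show ?thesis
          using te[OF i] Inr \<open>Inr b' \<in> t i\<close> by blast
      qed
      then have "t i \<union> Inl ` (left_vertices ?I e \<inter> A i) = e i" by blast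
      then show ?thesis by (simp only: restrict_apply i if_True)
    next
      case False
      have "e \<in> (\<Pi>\<^sub>E i\<in>?I. bipartite_cells (A i) (B i))"
        using e by (simp add: top_factors_def cube_factors_def)
      from PiE_arb[OF this False] False show ?thesis by (simp only: restrict_apply if_False)
    qed
  qed
next
  let ?I = "{1..n}"
  fix \<sigma> assume \<sigma>: "\<sigma> \<in> {\<sigma>. \<sigma> \<in> \<Gamma> \<and> simplex_dim \<sigma> = k \<and> left_vertices ?I t \<subset> \<sigma>}"
  let ?e = "restrict (\<lambda>i. t i \<union> Inl ` (\<sigma> \<inter> A i)) ?I"
  have "?e \<in> cube_factors ?I A B" and left: "left_vertices ?I ?e = \<sigma>"
    using cube_factors_extend[OF col t Inr] left_vertices_extend[OF col t Inr] \<sigma> by auto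
  moreover have "(\<exists>b. Inr b \<in> ?e i) \<and> t i \<subseteq> ?e i" if "i \<in> ?I" for i
    using Inr[OF that] that by auto
  ultimately show "?e \<in> top_factors ?I A B \<Gamma> k t"
    using \<sigma> by (simp only: top_factors_def simplex_dim_def left mem_Collect_eq) auto
  show "left_vertices ?I ?e = \<sigma>" by (fact left)
qed simp

section \<open>The cycle of cubes built from a cycle of \<Gamma>A\<close>

text \<open>Every face in \<open>X\<close> has to be checked, including the empty cell and faces
  with B-vertices that were not chosen. Each boundary coefficient becomes a sum over
  \<open>top_factors\<close>, which vanishes by an exchange, by the cycle condition on
  \<open>z\<close>, or because it is empty.\<close>

lemma coupled_link_cycle:
  fixes z :: "'a set \<Rightarrow> bit"
  assumes n: "n \<ge> 1" and col: "coloured_complex n \<Gamma> A"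
    and X: "X = PiE {1..n} ` {e \<in> cube_factors {1..n} A B. left_vertices {1..n} e \<in> \<Gamma>}"
    and dim: "\<And>\<sigma>. \<sigma> \<in> \<Gamma> \<Longrightarrow> simplex_dim \<sigma> \<le> k"
    and b: "\<And>i. i \<in> {1..n} \<Longrightarrow> {b i, b' i} \<subseteq> B i \<and> b i \<noteq> b' i"
    and z: "chain_boundary \<Gamma> simplex_dim k z = (\<lambda>_. 0)"
  defines "Z \<equiv> \<lambda>Q. if Q \<in> PiE {1..n} ` top_factors {1..n} A (\<lambda>i. {b i, b' i}) \<Gamma> k (\<lambda>_. {})
    then z (left_vertices {1..n} (coord Q)) else 0"
  shows "Z \<in> carrier (chain_group (insert {} X) cube_dim (k + 1))"
    and "chain_boundary (insert {} X) cube_dim (k + 1) Z = (\<lambda>_. 0)"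
proof -
  let ?I = "{1..n}" and ?B = "\<lambda>i. {b i, b' i}"
  let ?top = "top_factors ?I A ?B \<Gamma> k"
  note disj = coloured_complexD(2)[OF col]
  have sub: "cube_factors ?I A ?B \<subseteq> cube_factors ?I A B"
    unfolding cube_factors_def using b by (intro PiE_mono) (fastforce simp: bipartite_cells_def)
  have top: "PiE ?I e \<in> X \<and> cube_dim (PiE ?I e) = k + 1" if "e \<in> ?top (\<lambda>_. {})" for e
  proof -
    have e: "e \<in> cube_factors ?I A ?B" "left_vertices ?I e \<in> \<Gamma>"
        "int (card (left_vertices ?I e)) = k + 1" "\<forall>i\<in>?I. \<exists>b. Inr b \<in> e i"
      using that by (simp_all add: top_factors_def)
    then have "cube_dim (PiE ?I e) = k + 1"
      using cube_dim_eq_card_iff[OF e(1) disj] by simp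
    moreover have "PiE ?I e \<in> X"
      unfolding X using e(1,2) sub by blast
    ultimately show ?thesis by blast
  qed
  show "Z \<in> carrier (chain_group (insert {} X) cube_dim (k + 1))"
    using top by (auto simp: chain_group_def Z_def split: if_splits)
  have "(\<Sum>Q | Q \<in> insert {} X \<and> cube_dim Q = k + 1 \<and> \<tau> \<subset> Q. Z Q) = 0" (is "sum Z ?S = 0")
    if \<tau>: "\<tau> \<in> insert {} X" "cube_dim \<tau> = k" for \<tau>
  \<comment> \<open>An infinite sum is 0 by convention, so finiteness of \<open>X\<close> need not
    be known.\<close>
  proof (cases "finite ?S")
    case fin: True
    obtain t where t0: "\<tau> = {} \<Longrightarrow> t = (\<lambda>_. {})"
      and t: "\<tau> \<noteq> {} \<Longrightarrow> t \<in> cube_factors ?I A B \<and> left_vertices ?I t \<in> \<Gamma> \<and> \<tau> = PiE ?I t"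
    proof (cases "\<tau> = {}")
      case False
      then obtain e where "e \<in> cube_factors ?I A B" "left_vertices ?I e \<in> \<Gamma>" "\<tau> = PiE ?I e"
        using \<tau>(1) unfolding X by blast
      then show ?thesis using that False by blast
    qed (use that in blast)
    have subset: "\<tau> \<subseteq> PiE ?I e \<longleftrightarrow> (\<forall>i\<in>?I. t i \<subseteq> e i)" for e
    proof (cases "\<tau> = {}")
      case False
      then show ?thesis using t PiE_le_iff by metis
    qed (simp add: t0)
    \<comment> \<open>Only cubes from \<open>?top (\<lambda>_. {})\<close> can carry a nonzero
      coefficient; those that contain \<tau> are given by \<open>?top t\<close>, so the sum reduces
      to these.\<close>
    have top_t: "e \<in> ?top t \<longleftrightarrow> e \<in> ?top (\<lambda>_. {}) \<and> \<tau> \<subseteq> PiE ?I e" for e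
      unfolding subset top_factors_def mem_Collect_eq by blast
    have "PiE ?I ` ?top t \<subseteq> ?S"
    proof (rule image_subsetI)
      fix e assume "e \<in> ?top t"
      then have "\<tau> \<subseteq> PiE ?I e" "PiE ?I e \<in> X" "cube_dim (PiE ?I e) = k + 1"
        using top_t top by blast+
      moreover from this have "\<tau> \<noteq> PiE ?I e" using \<tau>(2) by auto
      ultimately show "PiE ?I e \<in> ?S" by blast
    qed
    moreover have "Z Q = 0" if "Q \<in> ?S - PiE ?I ` ?top t" for Q
    proof -
      have "Q \<notin> PiE ?I ` ?top (\<lambda>_. {})"
        using that top_t by blast
      then show ?thesis unfolding Z_def by (rule if_not_P)
    qed
    ultimately have "sum Z ?S = sum Z (PiE ?I ` ?top t)"
      using fin by (intro sum.mono_neutral_right) auto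
    also have "\<dots> = (\<Sum>e\<in>?top t. Z (PiE ?I e))"
      using inj_on_subset[OF inj_on_PiE_cube_factors, of "?top t" ?I A ?B]
      by (subst sum.reindex) (auto simp: top_factors_def)
    also have "\<dots> = (\<Sum>e\<in>?top t. z (left_vertices ?I e))"
    proof (rule sum.cong)
      fix e assume "e \<in> ?top t"
      then have "e \<in> ?top (\<lambda>_. {})" "e \<in> cube_factors ?I A ?B"
        by (auto simp: top_factors_def)
      then show "Z (PiE ?I e) = z (left_vertices ?I e)"
        by (simp add: Z_def left_vertices_coord)
    qed simp
    also have "\<dots> = 0"
    proof (cases "\<forall>i\<in>?I. \<exists>b. Inr b \<in> t i")
      case False
      then obtain i where "i \<in> ?I" "\<And>b. Inr b \<notin> t i" by blast
      then show ?thesis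
        using b by (intro sum_top_factors_exchange) auto
    next
      case Inr: True
      \<comment> \<open>For the empty cell no factor has a B-end; as there is at least one factor,
        that cell belongs to the previous case.\<close>
      then have "\<tau> \<noteq> {}" using n by (auto simp: t0)
      note t = t[OF this]
      have card: "int (card (left_vertices ?I t)) = k"
        using t \<tau>(2) Inr cube_dim_eq_card_iff[of t ?I A B, OF _ disj] by auto
      show ?thesis
      \<comment> \<open>If \<tau> uses a B-vertex that was not chosen, no cube with a coefficient
        contains it. If some cube in \<open>?top t\<close> exists, \<tau> is a face of it and uses
        chosen points only.\<close>
      proof (cases "?top t = {}")
        case False
        then obtain e where e: "e \<in> cube_factors ?I A ?B" "\<And>i. i \<in> ?I \<Longrightarrow> t i \<subseteq> e i"
          by (auto simp: top_factors_def)
        have "t i \<in> bipartite_cells (A i) (?B i)" if "i \<in> ?I" for i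
        proof -
          have ei: "e i \<in> bipartite_cells (A i) (?B i)"
            using e(1) that unfolding cube_factors_def by (rule PiE_mem)
          have "t i \<in> bipartite_cells (A i) (B i)"
            using t that unfolding cube_factors_def by (blast dest: PiE_mem)
          then have "t i \<noteq> {}" by (simp add: bipartite_cells_iff)
          with ei e(2)[OF that] show ?thesis by (rule bipartite_cells_subset)
        qed
        then have "t \<in> cube_factors ?I A ?B"
          using t by (simp add: cube_factors_def PiE_iff)
        then have "(\<Sum>e\<in>?top t. z (left_vertices ?I e)) =
          (\<Sum>\<sigma> | \<sigma> \<in> \<Gamma> \<and> simplex_dim \<sigma> = k \<and> left_vertices {1..n} t \<subset> \<sigma>. z \<sigma>)"
          using Inr card by (intro sum_top_factors_link[OF col]) auto
        \<comment> \<open>The set \<open>left_vertices ?I t\<close> is a simplex of dimension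
          \<open>k - 1\<close>, having \<open>k\<close> elements.\<close>
        also have "\<dots> = chain_boundary \<Gamma> simplex_dim k z (left_vertices ?I t)"
          using t card by (simp add: chain_boundary_def simplex_dim_def)
        finally show ?thesis using z by simp
      qed simp
    qed
    finally show ?thesis .
  qed simp
  then show "chain_boundary (insert {} X) cube_dim (k + 1) Z = (\<lambda>_. 0)"
    unfolding chain_boundary_def by auto
qed

section \<open>Nonvanishing of the cycle and absence of cubes of dimension
  \<open>k + 2\<close>\<close>

theorem corollary1p6:
  fixes n :: nat and k :: int
    and \<Gamma>A :: "'a set set" and A :: "nat \<Rightarrow> 'a set"
    and \<Gamma>B :: "'b set set" and B :: "nat \<Rightarrow> 'b set"
  assumes "n \<ge> 1"
    and "coloured_complex n \<Gamma>A A"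
    and "complex_dim \<Gamma>A = k"
    and "\<not> trivial_group (simplicial_homology k \<Gamma>A)"
    and "coloured_complex n \<Gamma>B B"
    and "\<Gamma>B = simplicial_join {1..n} (\<lambda>i. discrete_complex (B i))"
    and "\<forall>i\<in>{1..n}. card (B i) \<ge> 2"
  shows "\<not> trivial_group (cubical_homology (k + 1) (coupled_link_complex n \<Gamma>A A \<Gamma>B B))"
proof -
  let ?I = "{1..n}"
  define X where "X = coupled_link_complex n \<Gamma>A A \<Gamma>B B"
  note col = assms(2)
  note cplx = coloured_complexD(1)[OF col] and disj = coloured_complexD(2)[OF col]
  have X: "X = PiE ?I ` {e \<in> cube_factors ?I A B. left_vertices ?I e \<in> \<Gamma>A}"
    unfolding X_def by (rule coupled_link_complex_join[OF cplx assms(6)])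
  have dim: "simplex_dim \<sigma> \<le> k" if "\<sigma> \<in> \<Gamma>A" for \<sigma>
    using assms(3) cplx that by (auto simp: complex_dim_def abstract_simplicial_complex_def)
  then have "simplex_dim \<sigma> \<noteq> k + 1" if "\<sigma> \<in> \<Gamma>A" for \<sigma>
    using that by force
  then obtain z where z: "z \<in> carrier (chain_group \<Gamma>A simplex_dim k)"
      "chain_boundary \<Gamma>A simplex_dim k z = (\<lambda>_. 0)" "z \<noteq> (\<lambda>_. 0)"
    using assms(4) trivial_cell_homology_top[of \<Gamma>A simplex_dim k]
    unfolding simplicial_homology_def by blast
  obtain \<sigma> where "z \<sigma> \<noteq> 0" using z(3) by blast
  then have \<sigma>: "z \<sigma> \<noteq> 0" "\<sigma> \<in> \<Gamma>A" "simplex_dim \<sigma> = k"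
    using z(1) by (auto simp: chain_group_def)
  have "\<exists>b b'. {b, b'} \<subseteq> B i \<and> b \<noteq> b'" if "i \<in> ?I" for i
  proof -
    have "2 \<le> card (B i)" using assms(7) that by blast
    then obtain T where "T \<subseteq> B i" "card T = 2" by (meson obtain_subset_with_card_n)
    then show ?thesis by (metis card_2_iff)
  qed
  then obtain b b' where b: "\<And>i. i \<in> ?I \<Longrightarrow> {b i, b' i} \<subseteq> B i \<and> b i \<noteq> b' i"
    by metis
  let ?top = "top_factors ?I A (\<lambda>i. {b i, b' i}) \<Gamma>A k (\<lambda>_. {})"
  define Z where "Z = (\<lambda>Q. if Q \<in> PiE ?I ` ?top then z (left_vertices ?I (coord Q)) else 0)"
  have cycle: "Z \<in> carrier (chain_group (insert {} X) cube_dim (k + 1))"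
      "chain_boundary (insert {} X) cube_dim (k + 1) Z = (\<lambda>_. 0)"
    unfolding Z_def using coupled_link_cycle[OF assms(1) col X dim b z(2)] by auto
  have "Z \<noteq> (\<lambda>_. 0)"
  proof -
    \<comment> \<open>The vertex with entries \<open>b i\<close> is enlarged by a simplex \<sigma>
      in the support of \<open>z\<close>, giving a cube with coefficient
      \<open>z \<sigma>\<close>.\<close>
    define t where "t = (\<lambda>i\<in>?I. {Inr (b i) :: 'a + 'b})"
    define e where "e = restrict (\<lambda>i. t i \<union> Inl ` (\<sigma> \<inter> A i)) ?I"
    have "t \<in> cube_factors ?I A (\<lambda>i. {b i, b' i})" "left_vertices ?I t \<subseteq> \<sigma>"
        "\<And>i. i \<in> ?I \<Longrightarrow> \<exists>b. Inr b \<in> t i"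
      by (auto simp: t_def cube_factors_def bipartite_cells_iff left_vertices_def)
    then have e: "e \<in> cube_factors ?I A (\<lambda>i. {b i, b' i})" "left_vertices ?I e = \<sigma>"
      unfolding e_def
      using cube_factors_extend[OF col] left_vertices_extend[OF col] \<sigma>(2) by blast+
    then have "e \<in> ?top"
      using \<sigma>(2,3) by (auto simp: top_factors_def simplex_dim_def e_def t_def)
    then have "Z (PiE ?I e) = z \<sigma>"
      using e by (simp add: Z_def left_vertices_coord)
    then show ?thesis using \<sigma>(1) by auto
  qed
  moreover have "cube_dim Q \<noteq> k + 1 + 1" if "Q \<in> insert {} X" for Q
  proof (cases "Q = {}")
    case True
    \<comment> \<open>The empty cell has dimension -1, and \<open>k + 2\<close> is at least 1
      because \<open>k\<close> is the dimension of a simplex.\<close>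
    then show ?thesis using \<sigma>(3) by (simp add: cube_dim_def simplex_dim_def)
  next
    case False
    then have "Q \<in> PiE ?I ` {e \<in> cube_factors ?I A B. left_vertices ?I e \<in> \<Gamma>A}"
      using that X by blast
    then obtain e where e: "e \<in> cube_factors ?I A B" "left_vertices ?I e \<in> \<Gamma>A" "Q = PiE ?I e"
      by blast
    have "cube_dim Q \<le> int (card (left_vertices ?I e))"
      unfolding e(3) using e(1) disj by (rule cube_dim_le_card) simp
    then show ?thesis
      using dim[OF e(2)] by (simp add: simplex_dim_def)
  qed
  ultimately show ?thesis
    using cycle trivial_cell_homology_top[of "insert {} X" cube_dim "k + 1"]
    unfolding cubical_homology_def X_def[symmetric] by blast
qed

end
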